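(* Let $G:\mathbb{R}^n\to\mathbb{R}^n$ be a contraction with Lipschitz constant $L<1$, let $\varepsilon>0$ be the tolerance, and let $\mathbf{x}^0\in\mathbb{R}^n$. Then the sequence generated by the On-the-fly Accelerated Inexact Picard Iterations algorithm (described in the context) started from $\mathbf{x}^0$ stays at a distance at most $\varepsilon$ from the sequence generated by the exact fixed point scheme $\mathbf{y}^{0}=\mathbf{x}^0$, $\mathbf{y}^{m+1}=G(\mathbf{y}^m)$. That is, if the algorithm's iterates are re-indexed so that rejected steps (which merely repeat the current iterate) are not counted, the $m$-th iterate of the algorithm is at distance at most $\varepsilon$ from $\mathbf{y}^m$ for every $m$ reached by the algorithm.
   Context: $\|\cdot\|$ is a norm on $\mathbb{R}^n$; distances are measured in it. $G$ is a contraction with constant $L$ if $L<1$ and $\|G(\mathbf{x})-G(\mathbf{z})\|\le L\|\mathbf{x}-\mathbf{z}\|$ for all $\mathbf{x},\mathbf{z}$. Inexact operators: at iteration $k$, $G_k:\mathbb{R}^n\to\mathbb{R}^n$ is an available approximation of $G$ together with a number $\delta^k>0$ satisfying $\|G(\mathbf{x}^k)-G_k(\mathbf{x}^k)\|\le\delta^k$, where $\mathbf{x}^k$ is the current iterate of the algorithm. How $G_k$ and $\delta^k$ are constructed is arbitrary. Algorithm (On-the-fly Accelerated Inexact Picard Iterations). Inputs: $\mathbf{x}^0$, $\varepsilon$, $L$, a sample size $N_b$, and a maximal iteration number $k_{max}$. Initialize $k=0$, $\eta^0=\infty$, recompute = False, converged = False. While $k<k_{max}$ and not converged: (1) If $\eta^k>\varepsilon$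 or $k<N_b$ or recompute is True (exact step): set $\mathbf{x}^{k+1}=G(\mathbf{x}^k)$; construct $G_k$ and $\delta^k$ using the new data $\mathbf{x}^{k+1}$. If recompute is True, set $\eta^{k+1}=L\,\eta^k$ and recompute = False; otherwise set $\eta^{k+1}=\delta^k$. (2) Otherwise: set $G_k=G_{k-1}$, compute the trial point $\mathbf{x}_t=G_k(\mathbf{x}^k)$ and $\mathrm{newerr}=\delta^k+L\,\eta^k$. If $\mathrm{newerr}>\varepsilon$, reject the step: set $\mathbf{x}^{k+1}=\mathbf{x}^k$, $\eta^{k+1}=\eta^k$, and recompute = True. If $\mathrm{newerr}\le\varepsilon$, accept the step: set $\mathbf{x}^{k+1}=\mathbf{x}_t$ and $\eta^{k+1}=\mathrm{newerr}$. (3) If $\|\mathbf{x}^{k+1}-\mathbf{x}^k\|<\varepsilon$ and recompute is False: if $\|G(\mathbf{x}^{k+1})-\mathbf{x}^{k+1}\|<\varepsilon$, set converged = True; otherwise set recompute = True. (4) Replace $k$ by $k+1$. *)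

theory Defs
  imports "HOL-Analysis.Analysis"
begin

text \<open>The norm is an arbitrary one on \<open>real ^ 'n\<close>, not the Euclidean norm of the type class.\<close>

definition is_norm :: "(real ^ 'n \<Rightarrow> real) \<Rightarrow> bool" where
  "is_norm nrm \<longleftrightarrow>
     (\<forall>x. 0 \<le> nrm x) \<and>
     (\<forall>x. nrm x = 0 \<longleftrightarrow> x = 0) \<and>
     (\<forall>c x. nrm (c *\<^sub>R x) = \<bar>c\<bar> * nrm x) \<and>
     (\<forall>x y. nrm (x + y) \<le> nrm x + nrm y)"

definition contraction ::
  "(real ^ 'n \<Rightarrow> real) \<Rightarrow> (real ^ 'n \<Rightarrow> real ^ 'n) \<Rightarrow> real \<Rightarrow> bool" where
  "contraction nrm G L \<longleftrightarrow> L < 1 \<and> (\<forall>x z. nrm (G x - G z) \<le> L * nrm (x - z))"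

text \<open>The error indicator \<open>err\<close> (the paper's \<open>\<eta>\<close>) is extended real because it starts at \<open>\<infinity>\<close>.\<close>

record ('n::finite) picard_state =
  iterate :: "real ^ 'n"
  err :: ereal
  recompute :: bool
  converged :: bool

definition exact_step :: "real \<Rightarrow> nat \<Rightarrow> nat \<Rightarrow> ('n::finite) picard_state \<Rightarrow> bool" where
  "exact_step \<epsilon> Nb k s \<longleftrightarrow> err s > ereal \<epsilon> \<or> k < Nb \<or> recompute s"

definition newerr :: "real \<Rightarrow> real \<Rightarrow> ('n::finite) picard_state \<Rightarrow> ereal" where
  "newerr L \<delta>k s = ereal \<delta>k + ereal L * err s"

definition rejected_step :: "real \<Rightarrow> real \<Rightarrow> nat \<Rightarrow> real \<Rightarrow> nat \<Rightarrow> ('n::finite) picard_state \<Rightarrow> bool" where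
  "rejected_step L \<epsilon> Nb \<delta>k k s \<longleftrightarrow> \<not> exact_step \<epsilon> Nb k s \<and> newerr L \<delta>k s > ereal \<epsilon>"

text \<open>\<open>Gk\<close> and \<open>\<delta>k\<close> are the approximate operator and the error bound of iteration \<open>k\<close>;
  the requirement that inexact steps reuse the previous operator is part of \<open>admissible_operators\<close> below.\<close>

definition advance ::
  "(real ^ 'n \<Rightarrow> real ^ 'n) \<Rightarrow> real \<Rightarrow> real \<Rightarrow> nat \<Rightarrow> (real ^ 'n \<Rightarrow> real ^ 'n) \<Rightarrow> real \<Rightarrow>
   nat \<Rightarrow> 'n picard_state \<Rightarrow> 'n picard_state" where
  "advance G L \<epsilon> Nb Gk \<delta>k k s =
     (if exact_step \<epsilon> Nb k s then
        s\<lparr>iterate := G (iterate s),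
          err := (if recompute s then ereal L * err s else ereal \<delta>k),
          recompute := False\<rparr>
      else if rejected_step L \<epsilon> Nb \<delta>k k s then
        s\<lparr>recompute := True\<rparr>
      else
        s\<lparr>iterate := Gk (iterate s), err := newerr L \<delta>k s\<rparr>)"

text \<open>\<open>s\<close> is the state at the start of the iteration and \<open>t\<close> the state after \<open>advance\<close>.\<close>

definition check_convergence ::
  "(real ^ 'n \<Rightarrow> real) \<Rightarrow> (real ^ 'n \<Rightarrow> real ^ 'n) \<Rightarrow> real \<Rightarrow>
   'n picard_state \<Rightarrow> 'n picard_state \<Rightarrow> 'n picard_state" where
  "check_convergence nrm G \<epsilon> s t =
     (if nrm (iterate t - iterate s) < \<epsilon> \<and> \<not> recompute t then
        (if nrm (G (iterate t) - iterate t) < \<epsilon> then t\<lparr>converged := True\<rparr>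
         else t\<lparr>recompute := True\<rparr>)
      else t)"

text \<open>The state at loop counter \<open>k\<close>, when the operators and error bounds occurring in the run are
  \<open>Gs\<close> and \<open>\<delta>\<close>; it stays constant once the loop has been left.  Since \<open>Gs\<close> and \<open>\<delta>\<close>
  are arbitrary, a construction that depends on the history of the run is covered by taking
  the sequences it produces.\<close>

primrec picard_run ::
  "(real ^ 'n \<Rightarrow> real) \<Rightarrow> (real ^ 'n \<Rightarrow> real ^ 'n) \<Rightarrow> real \<Rightarrow> real \<Rightarrow> nat \<Rightarrow> nat \<Rightarrow> real ^ 'n \<Rightarrow>
   (nat \<Rightarrow> real ^ 'n \<Rightarrow> real ^ 'n) \<Rightarrow> (nat \<Rightarrow> real) \<Rightarrow> nat \<Rightarrow> 'n picard_state" where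
  "picard_run nrm G L \<epsilon> Nb kmax x0 Gs \<delta> 0 =
     \<lparr>iterate = x0, err = \<infinity>, recompute = False, converged = False\<rparr>"
| "picard_run nrm G L \<epsilon> Nb kmax x0 Gs \<delta> (Suc k) =
     (let s = picard_run nrm G L \<epsilon> Nb kmax x0 Gs \<delta> k in
      if k < kmax \<and> \<not> converged s
      then check_convergence nrm G \<epsilon> s (advance G L \<epsilon> Nb (Gs k) (\<delta> k) k s)
      else s)"

text \<open>The requirements on \<open>Gs\<close> and \<open>\<delta>\<close>, imposed at the executed iterations only.  The clause
  \<open>Gs k = Gs (k - 1)\<close> is never imposed at \<open>k = 0\<close>, where the step is exact because
  \<open>err = \<infinity>\<close>.\<close>

definition admissible_operators ::
  "(real ^ 'n \<Rightarrow> real) \<Rightarrow> (real ^ 'n \<Rightarrow> real ^ 'n) \<Rightarrow> real \<Rightarrow> real \<Rightarrow> nat \<Rightarrow> nat \<Rightarrow> real ^ 'n \<Rightarrow>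
   (nat \<Rightarrow> real ^ 'n \<Rightarrow> real ^ 'n) \<Rightarrow> (nat \<Rightarrow> real) \<Rightarrow> bool" where
  "admissible_operators nrm G L \<epsilon> Nb kmax x0 Gs \<delta> \<longleftrightarrow>
     (\<forall>k<kmax. let s = picard_run nrm G L \<epsilon> Nb kmax x0 Gs \<delta> k in
        \<not> converged s \<longrightarrow>
          0 < \<delta> k \<and>
          nrm (G (iterate s) - Gs k (iterate s)) \<le> \<delta> k \<and>
          (\<not> exact_step \<epsilon> Nb k s \<longrightarrow> Gs k = Gs (k - 1)))"

text \<open>The iterates of the run re-indexed without the rejected steps: \<open>x0\<close> followed by the outcome
  of every executed iteration that is not rejected, in order.\<close>

definition counted_iterates ::
  "(real ^ 'n \<Rightarrow> real) \<Rightarrow> (real ^ 'n \<Rightarrow> real ^ 'n) \<Rightarrow> real \<Rightarrow> real \<Rightarrow> nat \<Rightarrow> nat \<Rightarrow> real ^ 'n \<Rightarrow>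
   (nat \<Rightarrow> real ^ 'n \<Rightarrow> real ^ 'n) \<Rightarrow> (nat \<Rightarrow> real) \<Rightarrow> (real ^ 'n) list" where
  "counted_iterates nrm G L \<epsilon> Nb kmax x0 Gs \<delta> =
     (let run = picard_run nrm G L \<epsilon> Nb kmax x0 Gs \<delta> in
      x0 # map (\<lambda>k. iterate (run (Suc k)))
             (filter (\<lambda>k. \<not> converged (run k) \<and> \<not> rejected_step L \<epsilon> Nb (\<delta> k) k (run k))
               [0..<kmax]))"

end

theory Submission imports Defs begin

text \<open>
  Let \<open>y\<close> run through the exact scheme in step with the counted iterations, so that the distance of
  the current iterate \<open>x\<close> from \<open>y\<close> is its accumulated error.  An inexact step turns an error \<open>d\<close>
  into at most \<open>\<delta> + L * d\<close>, an exact step into at most \<open>L * d\<close>, and a rejected step leaves it alone.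
  These are the updates of the indicator \<open>\<eta>\<close> (\<open>err\<close>), with one exception: an exact step taken
  without \<open>recompute\<close> resets \<open>\<eta>\<close> to \<open>\<delta>\<close>, a number unrelated to the error already accumulated.
  If there were such an error, \<open>\<eta>\<close> could fall below it.

  The reset is harmless because it happens only while \<open>x = y\<close>.  A reset needs \<open>\<eta> > \<epsilon>\<close> or \<open>k < Nb\<close>.
  Error enters only with an accepted inexact step, which leaves \<open>\<eta> \<le> \<epsilon>\<close>.
  From then on \<open>\<eta>\<close> never exceeds \<open>\<epsilon>\<close> again: accepted steps are tested for
  this, and recomputation multiplies \<open>\<eta>\<close> by \<open>L \<le> 1\<close>.  Moreover inexact steps
  do not occur while \<open>k < Nb\<close>.  The invariant is therefore that \<open>\<eta>\<close> bounds the error and that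
  the error is zero or \<open>\<eta> \<le> \<epsilon>\<close> (\<open>tracks\<close>), together with \<open>x = y\<close> as long as \<open>k \<le> Nb\<close>.
  It is preserved by a single iteration (\<open>advance_tracks\<close>), hence holds along the run
  (\<open>run_tracks\<close>), and in either alternative the error is at most \<open>\<epsilon>\<close>.
\<close>

lemma is_normD:
  assumes "is_norm nrm"
  shows "0 \<le> nrm x" and "nrm 0 = 0" and "nrm (x + y) \<le> nrm x + nrm y"
    and "nrm (x - y) = nrm (y - x)"
proof -
  show "0 \<le> nrm x" "nrm 0 = 0" "nrm (x + y) \<le> nrm x + nrm y"
    using assms by (auto simp: is_norm_def)
  have "nrm ((-1) *\<^sub>R (y - x)) = \<bar>-1\<bar> * nrm (y - x)"
    using assms unfolding is_norm_def by blast
  then show "nrm (x - y) = nrm (y - x)" by simp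
qed

text \<open>The space \<open>real ^ 'n\<close> has at least dimension one, so it contains two points at positive
  distance, which a negative constant would have to map to points at negative distance.\<close>

lemma contraction_constant_nonneg:
  fixes nrm :: "real ^ 'n \<Rightarrow> real"
  assumes "is_norm nrm" and "contraction nrm G L"
  shows "0 \<le> L"
proof -
  have "nrm 1 \<noteq> 0" using assms(1) by (simp add: is_norm_def)
  then have "0 < nrm 1" using is_normD(1)[OF assms(1), of 1] by linarith
  moreover have "0 \<le> L * nrm (1 - 0)"
    using assms(2) is_normD(1)[OF assms(1)] unfolding contraction_def by (meson order_trans)
  ultimately show ?thesis by (simp add: zero_le_mult_iff)
qed

definition tracks ::
  "(real ^ 'n \<Rightarrow> real) \<Rightarrow> real \<Rightarrow> real ^ 'n \<Rightarrow> 'n picard_state \<Rightarrow> bool" where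
  "tracks nrm \<epsilon> y s \<longleftrightarrow>
     ereal (nrm (iterate s - y)) \<le> err s \<and> (iterate s = y \<or> err s \<le> ereal \<epsilon>)"

lemma tracks_imp_close:
  assumes "is_norm nrm" and "0 < \<epsilon>" and "tracks nrm \<epsilon> y s"
  shows "nrm (iterate s - y) \<le> \<epsilon>"
proof (cases "iterate s = y")
  case True
  then show ?thesis using assms(2) by (simp add: is_normD(2)[OF assms(1)])
next
  case False
  then have "ereal (nrm (iterate s - y)) \<le> ereal \<epsilon>"
    using assms(3) unfolding tracks_def by (meson order_trans)
  then show ?thesis by simp
qed

lemma iterate_err_check_convergence [simp]:
  "iterate (check_convergence nrm G \<epsilon> s t) = iterate t"
  "err (check_convergence nrm G \<epsilon> s t) = err t"
  by (simp_all add: check_convergence_def)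

lemma tracks_check_convergence [simp]:
  "tracks nrm \<epsilon> y (check_convergence nrm G \<epsilon> s t) \<longleftrightarrow> tracks nrm \<epsilon> y t"
  by (simp add: tracks_def)

text \<open>The invariant survives one iteration, the exact scheme moving on unless the step is rejected.
  The hypothesis on \<open>k < Nb\<close> covers the resets of the indicator forced by the sample size; for those
  forced by \<open>err s > \<epsilon>\<close> the invariant itself gives \<open>iterate s = y\<close>.\<close>

lemma advance_tracks:
  fixes nrm :: "real ^ 'n \<Rightarrow> real"
  assumes nrm: "is_norm nrm" and contr: "contraction nrm G L"
    and \<delta>: "0 < \<delta>k" and approx: "nrm (G (iterate s) - Gk (iterate s)) \<le> \<delta>k"
    and tr: "tracks nrm \<epsilon> y s" and early: "k < Nb \<Longrightarrow> iterate s = y"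
  shows "tracks nrm \<epsilon> (if rejected_step L \<epsilon> Nb \<delta>k k s then y else G y)
           (advance G L \<epsilon> Nb Gk \<delta>k k s)"
proof -
  have L: "0 \<le> L" "L \<le> 1"
    using contraction_constant_nonneg[OF nrm contr] contr by (auto simp: contraction_def)
  have step: "nrm (G (iterate s) - G y) \<le> L * nrm (iterate s - y)"
    using contr by (simp add: contraction_def)
  have bound: "ereal (nrm (iterate s - y)) \<le> err s"
    and small: "iterate s \<noteq> y \<Longrightarrow> err s \<le> ereal \<epsilon>"
    using tr by (auto simp: tracks_def)
  have err0: "0 \<le> err s"
    using bound is_normD(1)[OF nrm] by (meson ereal_less_eq(5) order_trans)
  have bound_L: "ereal (L * nrm (iterate s - y)) \<le> ereal L * err s"
    using ereal_mult_left_mono[OF bound, of "ereal L"] L(1) by simp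
  consider (rejected) "rejected_step L \<epsilon> Nb \<delta>k k s"
    | (recomputed) "exact_step \<epsilon> Nb k s" "recompute s"
    | (reset) "exact_step \<epsilon> Nb k s" "\<not> recompute s"
    | (accepted) "\<not> exact_step \<epsilon> Nb k s" "\<not> rejected_step L \<epsilon> Nb \<delta>k k s"
    by blast
  then show ?thesis
  proof cases
    case rejected
    then have "\<not> exact_step \<epsilon> Nb k s" by (simp add: rejected_step_def)
    with rejected tr show ?thesis by (simp add: advance_def tracks_def)
  next
    case recomputed
    have "ereal (nrm (G (iterate s) - G y)) \<le> ereal L * err s"
      using step bound_L by (meson ereal_less_eq(3) order_trans)
    moreover have "ereal L * err s \<le> ereal \<epsilon>" if "iterate s \<noteq> y"
    proof -
      have "ereal L * err s \<le> 1 * err s"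
        using L(2) err0 by (intro ereal_mult_right_mono) simp_all
      then show ?thesis using small[OF that] by simp
    qed
    ultimately show ?thesis
      using recomputed by (auto simp: advance_def tracks_def rejected_step_def)
  next
    case reset
    have "iterate s = y"
      using reset early small by (force simp: exact_step_def)
    then show ?thesis
      using reset \<delta> by (simp add: advance_def tracks_def rejected_step_def is_normD(2)[OF nrm])
  next
    case accepted
    have "nrm (Gk (iterate s) - G y)
        \<le> nrm (Gk (iterate s) - G (iterate s)) + nrm (G (iterate s) - G y)"
      using is_normD(3)[OF nrm, of "Gk (iterate s) - G (iterate s)" "G (iterate s) - G y"] by simp
    also have "\<dots> \<le> \<delta>k + L * nrm (iterate s - y)"
      using approx step is_normD(4)[OF nrm, of "Gk (iterate s)"] by (simp add: add_mono)
    finally have "ereal (nrm (Gk (iterate s) - G y)) \<le> ereal \<delta>k + ereal (L * nrm (iterate s - y))"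
      by simp
    also have "\<dots> \<le> newerr L \<delta>k s"
      unfolding newerr_def using bound_L by (intro add_left_mono)
    finally show ?thesis
      using accepted by (auto simp: advance_def tracks_def rejected_step_def)
  qed
qed

text \<open>The number of counted iterations before iteration \<open>k\<close> is the index that the exact scheme has
  reached by then.\<close>

lemma run_tracks:
  fixes nrm :: "real ^ 'n \<Rightarrow> real"
    and G :: "real ^ 'n \<Rightarrow> real ^ 'n"
  assumes nrm: "is_norm nrm" and contr: "contraction nrm G L"
    and adm: "admissible_operators nrm G L \<epsilon> Nb kmax x0 Gs \<delta>"
  defines "run \<equiv> picard_run nrm G L \<epsilon> Nb kmax x0 Gs \<delta>"
  defines "counted \<equiv> \<lambda>k. \<not> converged (run k) \<and> \<not> rejected_step L \<epsilon> Nb (\<delta> k) k (run k)"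
  defines "exact \<equiv> \<lambda>k. (G ^^ length (filter counted [0..<k])) x0"
  assumes "k \<le> kmax"
  shows "tracks nrm \<epsilon> (exact k) (run k) \<and> (k \<le> Nb \<longrightarrow> iterate (run k) = exact k)"
  using \<open>k \<le> kmax\<close>
proof (induction k)
  case 0
  show ?case by (simp add: run_def exact_def tracks_def is_normD(2)[OF nrm])
next
  case (Suc k)
  then have IH: "tracks nrm \<epsilon> (exact k) (run k)" "k \<le> Nb \<Longrightarrow> iterate (run k) = exact k"
    and k: "k < kmax" by auto
  show ?case
  proof (cases "converged (run k)")
    case True
    then have "run (Suc k) = run k" "exact (Suc k) = exact k"
      by (simp_all add: run_def exact_def counted_def)
    then show ?thesis using IH by simp
  next
    case False
    define t where "t = advance G L \<epsilon> Nb (Gs k) (\<delta> k) k (run k)"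
    have run_Suc: "run (Suc k) = check_convergence nrm G \<epsilon> (run k) t"
      using False k by (simp add: run_def t_def Let_def)
    have exact_Suc: "exact (Suc k) =
        (if rejected_step L \<epsilon> Nb (\<delta> k) k (run k) then exact k else G (exact k))"
      using False by (simp add: exact_def counted_def)
    have "0 < \<delta> k" "nrm (G (iterate (run k)) - Gs k (iterate (run k))) \<le> \<delta> k"
      using adm k False unfolding admissible_operators_def run_def Let_def by auto
    from advance_tracks[where Gk = "Gs k" and k = k and Nb = Nb, OF nrm contr this IH(1)] IH(2)
    have "tracks nrm \<epsilon> (exact (Suc k)) t"
      by (simp add: t_def exact_Suc)
    moreover have "iterate t = exact (Suc k)" if "Suc k \<le> Nb"
    proof -
      have "exact_step \<epsilon> Nb k (run k)" using that by (simp add: exact_step_def)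
      then show ?thesis
        using that IH(2) by (simp add: t_def exact_Suc advance_def rejected_step_def)
    qed
    ultimately show ?thesis by (simp add: run_Suc)
  qed
qed

lemma length_filter_upt_before_nth:
  assumes "j < length (filter P [0..<n])"
  defines "k \<equiv> filter P [0..<n] ! j"
  shows "k < n" and "P k" and "length (filter P [0..<k]) = j"
proof -
  have "filter P [0..<n] ! j < n \<and> P (filter P [0..<n] ! j) \<and>
      length (filter P [0..<filter P [0..<n] ! j]) = j"
    using assms(1)
  proof (induction n)
    case 0
    then show ?case by simp
  next
    case (Suc n)
    then show ?case
      by (cases "j < length (filter P [0..<n])") (auto simp: nth_append less_Suc_eq split: if_splits)
  qed
  then show "k < n" "P k" "length (filter P [0..<k]) = j"
    by (simp_all add: k_def)
qed

theorem corollary3p1: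
  fixes nrm :: "real ^ 'n \<Rightarrow> real"
    and G :: "real ^ 'n \<Rightarrow> real ^ 'n"
    and Gs :: "nat \<Rightarrow> real ^ 'n \<Rightarrow> real ^ 'n"
    and \<delta> :: "nat \<Rightarrow> real"
    and L \<epsilon> :: real
    and Nb kmax :: nat
    and x0 :: "real ^ 'n"
  assumes "is_norm nrm"
    and "contraction nrm G L"
    and "0 < \<epsilon>"
    and "admissible_operators nrm G L \<epsilon> Nb kmax x0 Gs \<delta>"
  shows "\<forall>m < length (counted_iterates nrm G L \<epsilon> Nb kmax x0 Gs \<delta>).
           nrm (counted_iterates nrm G L \<epsilon> Nb kmax x0 Gs \<delta> ! m - (G ^^ m) x0) \<le> \<epsilon>"
proof (intro allI impI)
  fix m
  define run where "run = picard_run nrm G L \<epsilon> Nb kmax x0 Gs \<delta>"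
  define counted where
    "counted = (\<lambda>k. \<not> converged (run k) \<and> \<not> rejected_step L \<epsilon> Nb (\<delta> k) k (run k))"
  let ?xs = "counted_iterates nrm G L \<epsilon> Nb kmax x0 Gs \<delta>"
  have xs: "?xs = x0 # map (\<lambda>k. iterate (run (Suc k))) (filter counted [0..<kmax])"
    by (simp add: counted_iterates_def run_def counted_def Let_def)
  assume m: "m < length ?xs"
  show "nrm (?xs ! m - (G ^^ m) x0) \<le> \<epsilon>"
  proof (cases m)
    case 0
    then show ?thesis using assms(3) by (simp add: xs is_normD(2)[OF assms(1)])
  next
    case (Suc j)
    then have j: "j < length (filter counted [0..<kmax])" using m by (simp add: xs)
    define k where "k = filter counted [0..<kmax] ! j"
    note k = length_filter_upt_before_nth[OF j, folded k_def]
    have "length (filter counted [0..<Suc k]) = m"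
      using k Suc by simp
    then have "tracks nrm \<epsilon> ((G ^^ m) x0) (run (Suc k))"
      using run_tracks[OF assms(1,2,4), of "Suc k"] k(1)
      unfolding run_def[symmetric] counted_def[symmetric] by simp
    from tracks_imp_close[OF assms(1,3) this] show ?thesis
      using j by (simp add: xs Suc k_def)
  qed
qed

end
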